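(* Let $n,\sigma\in\mathbb{N}$ be positive integers, $\tau\in\mathbb{Z}$, $\Delta>0$, and $\alpha_1,\dots,\alpha_n,\phi_1,\dots,\phi_n\in\mathbb{C}$ with $2|\mathrm{Im}(\phi_i)|\Delta<\pi$ for all $i$. Let $f(t)=\sum_{i=1}^n\alpha_i\exp(-(t-\phi_i)^2)$ for $t\in\mathbb{R}$, and for $j=0,1,2,\dots$ put $$F_{\tau+j\sigma}:=\exp(2\tau j\sigma\Delta^2)\exp(j^2\sigma^2\Delta^2)\,f\big((\tau+j\sigma)\Delta\big).$$ Then the $n\times n$ Hankel matrix ${}^{\tau}_{\sigma}G_n:=\big(F_{\tau+(k+\ell)\sigma}\big)_{k,\ell=0}^{n-1}$ factorizes as $${}^{\tau}_{\sigma}G_n=E_nL_nA_nE_n^T,$$ where $E_n=\big(\exp(2\phi_i k\sigma\Delta)\big)_{k=0,\dots,n-1;\ i=1,\dots,n}$ (row index $k$, column index $i$), $A_n=\mathrm{diag}(\alpha_1\exp(-\phi_1^2),\dots,\alpha_n\exp(-\phi_n^2))$ and $L_n=\mathrm{diag}\big(\exp(-\tau^2\Delta^2+2\tau\Delta\phi_1),\dots,\exp(-\tau^2\Delta^2+2\tau\Delta\phi_n)\big)$.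
   Context: The symbol $F_{\tau+j\sigma}$ is indexed by $j$ for fixed $\sigma$ and $\tau$ (it depends on $\sigma,\tau,j$ separately, not only on the integer $\tau+j\sigma$). *)

theory Defs
  imports Complex_Main "Jordan_Normal_Form.Matrix"
begin

text \<open>
  The parameters \<open>\<alpha>\<^sub>i\<close>, \<open>\<phi>\<^sub>i\<close> are indexed by \<open>i = 1, \<dots>, n\<close>, whereas matrix entries are
  indexed from \<open>0\<close>. Hence matrix position \<open>i\<close> refers to the parameter with index \<open>Suc i\<close>
  wherever a matrix is indexed by the parameters.
\<close>

definition gauss_sum :: "nat \<Rightarrow> (nat \<Rightarrow> complex) \<Rightarrow> (nat \<Rightarrow> complex) \<Rightarrow> real \<Rightarrow> complex" where
  "gauss_sum n \<alpha> \<phi> t = (\<Sum>i = 1..n. \<alpha> i * exp (- (complex_of_real t - \<phi> i)\<^sup>2))"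

text \<open>
  The number usually written \<open>F\<^bsub>\<tau>+j\<sigma>\<^esub>\<close>. It depends on \<open>\<tau>\<close>, \<open>\<sigma>\<close> and \<open>j\<close> separately, not only
  on the integer \<open>\<tau> + j\<sigma>\<close>, so these are separate arguments.
\<close>

definition mod_sample :: "(real \<Rightarrow> complex) \<Rightarrow> real \<Rightarrow> int \<Rightarrow> nat \<Rightarrow> nat \<Rightarrow> complex" where
  "mod_sample f \<Delta> \<tau> \<sigma> j =
     complex_of_real (exp (2 * real_of_int \<tau> * real j * real \<sigma> * \<Delta>\<^sup>2)) *
     complex_of_real (exp ((real j)\<^sup>2 * (real \<sigma>)\<^sup>2 * \<Delta>\<^sup>2)) *
     f ((real_of_int \<tau> + real j * real \<sigma>) * \<Delta>)"

definition hankel_mat :: "nat \<Rightarrow> (nat \<Rightarrow> 'a) \<Rightarrow> 'a mat" where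
  "hankel_mat n h = mat n n (\<lambda>(k, l). h (k + l))"

definition G_mat :: "nat \<Rightarrow> (real \<Rightarrow> complex) \<Rightarrow> real \<Rightarrow> int \<Rightarrow> nat \<Rightarrow> complex mat" where
  "G_mat n f \<Delta> \<tau> \<sigma> = hankel_mat n (mod_sample f \<Delta> \<tau> \<sigma>)"

definition E_mat :: "nat \<Rightarrow> (nat \<Rightarrow> complex) \<Rightarrow> real \<Rightarrow> nat \<Rightarrow> complex mat" where
  "E_mat n \<phi> \<Delta> \<sigma> =
     mat n n (\<lambda>(k, i). exp (2 * \<phi> (Suc i) * of_nat k * of_nat \<sigma> * complex_of_real \<Delta>))"

definition A_mat :: "nat \<Rightarrow> (nat \<Rightarrow> complex) \<Rightarrow> (nat \<Rightarrow> complex) \<Rightarrow> complex mat" where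
  "A_mat n \<alpha> \<phi> = mat_diag n (\<lambda>i. \<alpha> (Suc i) * exp (- (\<phi> (Suc i))\<^sup>2))"

definition L_mat :: "nat \<Rightarrow> (nat \<Rightarrow> complex) \<Rightarrow> real \<Rightarrow> int \<Rightarrow> complex mat" where
  "L_mat n \<phi> \<Delta> \<tau> =
     mat_diag n (\<lambda>i. exp (- (of_int \<tau>)\<^sup>2 * (complex_of_real \<Delta>)\<^sup>2
                          + 2 * of_int \<tau> * complex_of_real \<Delta> * \<phi> (Suc i)))"

end

theory Submission
  imports Defs
begin

text \<open>
  Completing the square: the two exponential factors of \<open>F\<^bsub>\<tau>+j\<sigma>\<^esub>\<close> cancel every part of
  \<open>-((\<tau> + j\<sigma>)\<Delta> - \<phi>)\<^sup>2\<close> that is quadratic in \<open>j\<close> or linear in \<open>j\<close> without \<open>\<phi>\<close>. Each summand of \<open>f\<close> then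
  depends on \<open>j\<close> only through \<open>exp (2\<phi>j\<sigma>\<Delta>)\<close>, which for \<open>j = k + l\<close> splits into a factor for \<open>k\<close>
  and a factor for \<open>l\<close>.
\<close>

lemma mod_sample_gauss_sum:
  "mod_sample (gauss_sum n \<alpha> \<phi>) \<Delta> \<tau> \<sigma> j =
    (\<Sum>i = 1..n. \<alpha> i * exp (- (\<phi> i)\<^sup>2)
       * exp (- (of_int \<tau>)\<^sup>2 * (complex_of_real \<Delta>)\<^sup>2 + 2 * of_int \<tau> * complex_of_real \<Delta> * \<phi> i)
       * exp (2 * \<phi> i * of_nat j * of_nat \<sigma> * complex_of_real \<Delta>))"
  unfolding mod_sample_def gauss_sum_def sum_distrib_left
proof (rule sum.cong[OF refl], goal_cases)
  case (1 i)
  let ?j = "of_nat j :: complex" and ?s = "of_nat \<sigma> :: complex" and ?t = "of_int \<tau> :: complex"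
    and ?D = "complex_of_real \<Delta>"
  have "exp (2 * ?t * ?j * ?s * ?D\<^sup>2) * exp (?j\<^sup>2 * ?s\<^sup>2 * ?D\<^sup>2)
          * exp (- ((?t + ?j * ?s) * ?D - \<phi> i)\<^sup>2)
      = exp (- (\<phi> i)\<^sup>2) * exp (- ?t\<^sup>2 * ?D\<^sup>2 + 2 * ?t * ?D * \<phi> i) * exp (2 * \<phi> i * ?j * ?s * ?D)"
    \<comment> \<open>Merging each side into a single exponential leaves a polynomial identity
      between exponents.\<close>
    unfolding exp_add[symmetric]
    by (rule arg_cong[where f = exp]) (simp add: power2_eq_square algebra_simps)
  then show ?case
    by (simp add: exp_of_real[symmetric] mult_ac)
qed

theorem theorem4:
  fixes n \<sigma> :: nat
    and \<tau> :: int
    and \<Delta> :: real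
    and \<alpha> \<phi> :: "nat \<Rightarrow> complex"
    and f :: "real \<Rightarrow> complex"
  assumes "n > 0" and "\<sigma> > 0" and "\<Delta> > 0"
    and "\<And>i. i \<in> {1..n} \<Longrightarrow> 2 * \<bar>Im (\<phi> i)\<bar> * \<Delta> < pi"
    and "\<And>t. f t = gauss_sum n \<alpha> \<phi> t"
  shows "G_mat n f \<Delta> \<tau> \<sigma> =
    E_mat n \<phi> \<Delta> \<sigma> * L_mat n \<phi> \<Delta> \<tau> * A_mat n \<alpha> \<phi> * transpose_mat (E_mat n \<phi> \<Delta> \<sigma>)"
proof -
  have E: "E_mat n \<phi> \<Delta> \<sigma> \<in> carrier_mat n n"
    by (simp add: E_mat_def)
  have f: "f = gauss_sum n \<alpha> \<phi>"
    using assms(5) by blast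
  show ?thesis
    \<comment> \<open>Diagonal factors on the right only scale columns, so the sole matrix product
      left to expand is the one with the transpose.\<close>
    unfolding L_mat_def A_mat_def mat_diag_mult_right[OF E]
      mat_diag_mult_right[OF mat_carrier]
  proof (rule eq_matI, goal_cases)
    case (1 k l)
    \<comment> \<open>The shift from \<open>{1..n}\<close> to indices below \<open>n\<close> matches
      the \<open>Suc i\<close> in the matrices; \<open>exp_add\<close> splits the exponential at
      \<open>k + l\<close>.\<close>
    then show ?case
      by (simp add: G_mat_def hankel_mat_def f mod_sample_gauss_sum E_mat_def scalar_prod_def
          atLeast0LessThan sum.atLeast1_atMost_eq distrib_left distrib_right exp_add mult_ac)
  qed (simp_all add: G_mat_def hankel_mat_def E_mat_def)
qed

end
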